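(* Let $\epsilon > 0$, and let $g:\mathbb{R}^n \rightarrow \mathbb{R}$ and $h:\mathbb{R}^n \rightarrow \mathbb{R}$ be convex functions on a convex compact set $X \subseteq \mathbb{R}^n$. Let $\bar{g}:\mathbb{R}^n \rightarrow \mathbb{R}$ and $\bar{h}:\mathbb{R}^n \rightarrow \mathbb{R}$ be $\epsilon$-polyhedral underestimators of $g$ and $h$ on $X$, respectively. Consider the problems $(P)$: $\min_{x\in X}(g(x)-h(x))$, $(P_{\bar g})$: $\min_{x\in X}(\bar g(x)-h(x))$, and $(P_{\bar h})$: $\min_{x\in X}(g(x)-\bar h(x))$. Let $x^g, x^h \in X$ be optimal solutions to $(P_{\bar g})$ and $(P_{\bar h})$, respectively, and let $z^*, z^g, z^h$ be the optimal values of $(P)$, $(P_{\bar g})$, $(P_{\bar h})$, respectively. Then $x^g$ and $x^h$ are $\epsilon$-solutions of $(P)$. Moreover, $0 \leq z^*-z^g \leq \epsilon$ and $0 \leq z^h-z^* \leq \epsilon$ hold.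
   Context: A function is polyhedral convex if its epigraph is a polyhedral convex set. For $\epsilon>0$ and a convex function $g$ on a convex set $X\subseteq\mathbb{R}^n$, a polyhedral convex function $\bar g:\mathbb{R}^n\to\mathbb{R}$ is called an $\epsilon$-polyhedral underestimator of $g$ on $X$ if $0\le g(x)-\bar g(x)\le \epsilon$ for all $x\in X$. A point $\bar x\in X$ is an $\epsilon$-solution of $(P)$ if $g(\bar x)-h(\bar x)\le \min_{x\in X}(g(x)-h(x))+\epsilon$. *)

theory Defs
  imports "HOL-Analysis.Analysis"
begin

definition polyhedral_convex :: "('a::euclidean_space \<Rightarrow> real) \<Rightarrow> bool" where
  "polyhedral_convex f \<longleftrightarrow> polyhedron (epigraph UNIV f)"

definition eps_polyhedral_underestimator ::
    "real \<Rightarrow> 'a::euclidean_space set \<Rightarrow> ('a \<Rightarrow> real) \<Rightarrow> ('a \<Rightarrow> real) \<Rightarrow> bool" where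
  "eps_polyhedral_underestimator \<epsilon> X g gb \<longleftrightarrow>
     polyhedral_convex gb \<and> (\<forall>x\<in>X. 0 \<le> g x - gb x \<and> g x - gb x \<le> \<epsilon>)"

(* The infimum is a real one, hence meaningful only if X is nonempty and f is bounded below
   on X; it equals the minimum whenever that is attained. A function that is convex only on X
   may jump at the boundary of X, so the minimum of a difference g - h need not be attained
   even for compact X. *)
definition optimal_value :: "'a set \<Rightarrow> ('a \<Rightarrow> real) \<Rightarrow> real" where
  "optimal_value X f = (INF x\<in>X. f x)"

definition eps_solution ::
    "real \<Rightarrow> 'a set \<Rightarrow> ('a \<Rightarrow> real) \<Rightarrow> ('a \<Rightarrow> real) \<Rightarrow> 'a \<Rightarrow> bool" where
  "eps_solution \<epsilon> X g h x \<longleftrightarrow>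
     x \<in> X \<and> g x - h x \<le> optimal_value X (\<lambda>y. g y - h y) + \<epsilon>"

end

theory Submission imports Defs begin

text \<open>
  Replacing \<open>g\<close> by an underestimator lowers
  the objective \<open>g - h\<close> by at most \<open>\<epsilon>\<close>, while replacing \<open>h\<close> by one raises it by at most \<open>\<epsilon>\<close>. A
  one-sided pointwise bound between two objectives passes to their infima, and going from a
  minimizer of the replaced objective back to the original one costs the two one-sided errors
  together; here one of them is \<open>0\<close> and the other is \<open>\<epsilon>\<close>. Both halves of the theorem are therefore
  instances of the lemma \<open>perturbed_minimizer\<close>, with the roles of the two errors exchanged.
  The infimum of \<open>g - h\<close> need not be attained, but it is bounded below because the replaced
  objective attains its minimum.
\<close>

lemma optimal_value_arg_min:
  fixes p :: "'a \<Rightarrow> real"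
  assumes "is_arg_min p (\<lambda>y. y \<in> X) x"
  shows "optimal_value X p = p x"
  unfolding optimal_value_def
  by (rule cInf_eq_minimum) (use assms in \<open>auto simp: is_arg_min_linorder\<close>)

text \<open>
  The constant \<open>a\<close> bounds how far \<open>p\<close> may exceed \<open>q\<close>, and \<open>b\<close> how far \<open>q\<close> may exceed \<open>p\<close>. The first
  bound turns the minimum of \<open>p\<close> into a lower bound for \<open>q\<close>; the second controls \<open>q\<close> at the
  minimizer of \<open>p\<close>. Keeping the two constants apart allows either of them to be \<open>0\<close>, so that the
  perturbation moves the optimal value in one direction only.
\<close>

lemma perturbed_minimizer:
  fixes p q :: "'a \<Rightarrow> real"
  assumes min: "is_arg_min p (\<lambda>y. y \<in> X) x"
    and pq: "\<And>y. y \<in> X \<Longrightarrow> p y \<le> q y + a"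
    and qp: "\<And>y. y \<in> X \<Longrightarrow> q y \<le> p y + b"
  shows "optimal_value X p \<le> optimal_value X q + a"
    and "optimal_value X q \<le> optimal_value X p + b"
    and "q x \<le> optimal_value X q + (a + b)"
proof -
  have x: "x \<in> X" and least: "\<And>y. y \<in> X \<Longrightarrow> p x \<le> p y"
    using min by (auto simp: is_arg_min_linorder)
  have val: "optimal_value X p = p x"
    using min by (rule optimal_value_arg_min)
  have lower: "p x - a \<le> q y" if "y \<in> X" for y
    using least[OF that] pq[OF that] by linarith
  have "p x - a \<le> optimal_value X q"
    unfolding optimal_value_def using x lower by (intro cINF_greatest) auto
  then show le: "optimal_value X p \<le> optimal_value X q + a"
    using val by linarith
  have "optimal_value X q \<le> q x"
    unfolding optimal_value_def using x lower by (intro cINF_lower bdd_belowI2) auto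
  then show "optimal_value X q \<le> optimal_value X p + b"
    using qp[OF x] val by linarith
  show "q x \<le> optimal_value X q + (a + b)"
    using qp[OF x] le val by linarith
qed

theorem theorem3p2:
  fixes g h gb hb :: "real ^ 'n \<Rightarrow> real"
    and X :: "(real ^ 'n) set"
    and xg xh :: "real ^ 'n"
    and \<epsilon> zs zg zh :: real
  assumes "\<epsilon> > 0"
    and "convex X" and "compact X"
    and "convex_on X g" and "convex_on X h"
    and "eps_polyhedral_underestimator \<epsilon> X g gb"
    and "eps_polyhedral_underestimator \<epsilon> X h hb"
    and "is_arg_min (\<lambda>x. gb x - h x) (\<lambda>x. x \<in> X) xg"
    and "is_arg_min (\<lambda>x. g x - hb x) (\<lambda>x. x \<in> X) xh"
    and "zs = optimal_value X (\<lambda>x. g x - h x)"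
    and "zg = optimal_value X (\<lambda>x. gb x - h x)"
    and "zh = optimal_value X (\<lambda>x. g x - hb x)"
  shows "eps_solution \<epsilon> X g h xg \<and> eps_solution \<epsilon> X g h xh
    \<and> 0 \<le> zs - zg \<and> zs - zg \<le> \<epsilon>
    \<and> 0 \<le> zh - zs \<and> zh - zs \<le> \<epsilon>"
proof -
  have g: "0 \<le> g x - gb x" "g x - gb x \<le> \<epsilon>" and h: "0 \<le> h x - hb x" "h x - hb x \<le> \<epsilon>"
    if "x \<in> X" for x
    using assms(6,7) that by (auto simp: eps_polyhedral_underestimator_def)
  have feasible: "xg \<in> X" "xh \<in> X"
    using assms(8,9) by (auto simp: is_arg_min_def)
  have "gb x - h x \<le> (g x - h x) + 0" "g x - h x \<le> (gb x - h x) + \<epsilon>" if "x \<in> X" for x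
    using g[OF that] by linarith+
  note G = perturbed_minimizer[OF assms(8), where q = "\<lambda>x. g x - h x", OF this]
  have "g x - hb x \<le> (g x - h x) + \<epsilon>" "g x - h x \<le> (g x - hb x) + 0" if "x \<in> X" for x
    using h[OF that] by linarith+
  note H = perturbed_minimizer[OF assms(9), where q = "\<lambda>x. g x - h x", OF this]
  show ?thesis
    using G H feasible assms(10-12) by (simp add: eps_solution_def)
qed

end
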